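(* Let $(X,d,E)$ and $(Y,\rho,F)$ be vector metric spaces and let $f$ and $g$ be vectorial continuous functions from $X$ to $Y$. If the set $\{x\in X:f(x)=g(x)\}$ is $E$-dense in $X$, then $f=g$.
   Context: In a Riesz space $E$, $a_n\downarrow 0$ means $(a_n)$ is a decreasing sequence in $E$ with $\inf_n a_n=0$. A vector metric ($E$-metric) on a non-empty set $X$, with $E$ a Riesz space, is a map $d:X\times X\to E$ such that (vm1) $d(x,y)=0$ if and only if $x=y$; (vm2) $d(x,y)\le d(x,z)+d(y,z)$ for all $x,y,z\in X$. The triple $(X,d,E)$ is a vector metric space. A sequence $(x_n)$ in $X$ is $E$-convergent to $x\in X$, written $x_n\xrightarrow{d,E}x$, if there is a sequence $(a_n)$ in $E$ with $a_n\downarrow 0$ and $d(x_n,x)\le a_n$ for all $n$. A subset $A\subseteq X$ is $E$-dense in $X$ if for every $x\in X$ there is a sequence $(x_n)$ in $A$ with $x_n\xrightarrow{d,E}x$. A function $f:(X,d,E)\to(Y,\rho,F)$ is vectorial continuous if, for every $x\in X$, $x_n\xrightarrow{d,E}x$ implies $f(x_n)\xrightarrow{\rho,F}f(x)$. *)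

theory Defs
  imports Complex_Main "HOL-Library.FuncSet" "HOL-Library.Lub_Glb"
begin

class riesz_space = ordered_real_vector + lattice

text \<open>Suprema and infima of sequences need not exist in a Riesz space, so
  \<open>inf a\<^sub>n = 0\<close> is stated as: \<open>0\<close> is the greatest lower bound of the range.\<close>

definition decreases_to_zero :: "(nat \<Rightarrow> 'e::riesz_space) \<Rightarrow> bool" where
  "decreases_to_zero a \<longleftrightarrow> decseq a \<and> isGlb UNIV (range a) 0"

text \<open>Spaces are carrier sets; the value of \<open>d\<close> outside the carrier is irrelevant.\<close>

locale vector_metric_space =
  fixes X :: "'x set" and d :: "'x \<Rightarrow> 'x \<Rightarrow> 'e::riesz_space"
  assumes nonempty: "X \<noteq> {}"
    and vm1: "x \<in> X \<Longrightarrow> y \<in> X \<Longrightarrow> d x y = 0 \<longleftrightarrow> x = y"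
    and vm2: "x \<in> X \<Longrightarrow> y \<in> X \<Longrightarrow> z \<in> X \<Longrightarrow> d x y \<le> d x z + d y z"

definition E_convergent ::
    "'x set \<Rightarrow> ('x \<Rightarrow> 'x \<Rightarrow> 'e::riesz_space) \<Rightarrow> (nat \<Rightarrow> 'x) \<Rightarrow> 'x \<Rightarrow> bool" where
  "E_convergent X d s x \<longleftrightarrow>
     range s \<subseteq> X \<and> x \<in> X \<and> (\<exists>a. decreases_to_zero a \<and> (\<forall>n. d (s n) x \<le> a n))"

definition E_dense ::
    "'x set \<Rightarrow> ('x \<Rightarrow> 'x \<Rightarrow> 'e::riesz_space) \<Rightarrow> 'x set \<Rightarrow> bool" where
  "E_dense X d A \<longleftrightarrow> A \<subseteq> X \<and> (\<forall>x\<in>X. \<exists>s. range s \<subseteq> A \<and> E_convergent X d s x)"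

definition vectorial_continuous ::
    "'x set \<Rightarrow> ('x \<Rightarrow> 'x \<Rightarrow> 'e::riesz_space) \<Rightarrow>
     'y set \<Rightarrow> ('y \<Rightarrow> 'y \<Rightarrow> 'f::riesz_space) \<Rightarrow> ('x \<Rightarrow> 'y) \<Rightarrow> bool" where
  "vectorial_continuous X d Y \<rho> f \<longleftrightarrow> f \<in> X \<rightarrow> Y \<and>
     (\<forall>x\<in>X. \<forall>s. E_convergent X d s x \<longrightarrow> E_convergent Y \<rho> (\<lambda>n. f (s n)) (f x))"

end

theory Submission
  imports Defs
begin

text \<open>The two images of a sequence in the coincidence set that converges to \<open>x\<close> are the same
  sequence, converging to both \<open>f x\<close> and \<open>g x\<close>, and vectorial limits are unique.\<close>

lemma decreases_to_zero_greatest: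
  assumes "decreases_to_zero a" and "\<And>n. c \<le> a n"
  shows "c \<le> 0"
  using assms
  by (auto simp: decreases_to_zero_def isGlb_def greatestP_def isLb_def setge_def setle_def)

text \<open>Decoupling the two indices is what allows the infima to be taken one at a time.\<close>

lemma decreases_to_zero_add_greatest:
  fixes c :: "'e::riesz_space"
  assumes a: "decreases_to_zero a" and b: "decreases_to_zero b"
    and le: "\<And>n. c \<le> a n + b n"
  shows "c \<le> 0"
proof -
  have "c \<le> a m + b n" for m n
  proof -
    \<comment> \<open>At the common index \<open>max m n\<close> the hypothesis applies, and
      monotonicity then relaxes each term to its own index.\<close>
    have "a (max m n) \<le> a m" "b (max m n) \<le> b n"
      using a b by (auto simp: decreases_to_zero_def intro: decseqD)
    then show ?thesis
      using le[of "max m n"] add_mono order_trans by blast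
  qed
  \<comment> \<open>With \<open>m\<close> fixed, \<open>c - a m\<close> is a lower bound of
    \<open>b\<close>; this turns \<open>c\<close> into a lower bound of \<open>a\<close>.\<close>
  then have "c - a m \<le> b n" for m n
    by (simp add: diff_le_eq add.commute)
  then have "c - a m \<le> 0" for m
    using b decreases_to_zero_greatest by blast
  then have "c \<le> a m" for m
    by simp
  then show ?thesis
    using a decreases_to_zero_greatest by blast
qed

context vector_metric_space
begin

lemma dist_self [simp]: "x \<in> X \<Longrightarrow> d x x = 0"
  by (simp add: vm1)

text \<open>The triangle inequality from \<open>x\<close> back to \<open>x\<close> through
  \<open>y\<close> bounds twice the distance below by 0, and scaling by 1/2 preserves the
  order.\<close>

lemma dist_nonneg:
  assumes "x \<in> X" "y \<in> X"
  shows "0 \<le> d x y"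
proof -
  have "0 \<le> d x y + d x y"
    using vm2[of x x y] assms by simp
  then have "0 \<le> (1/2) *\<^sub>R (d x y + d x y)"
    by (intro scaleR_nonneg_nonneg) simp_all
  then show ?thesis
    by (simp add: scaleR_half_double)
qed

text \<open>Taking \<open>x\<close> itself as the intermediate point in \<open>vm2\<close> leaves
  only the reversed distance. Exchanging the points yields symmetry.\<close>

lemma dist_commute_le:
  assumes "x \<in> X" "y \<in> X"
  shows "d x y \<le> d y x"
  using vm2[of x y x] assms by simp

text \<open>The distance between two limits lies below every sum of the two controlling terms, which
  forces it to be at most 0.\<close>

lemma E_convergent_unique:
  assumes u: "E_convergent X d s u" and v: "E_convergent X d s v"
  shows "u = v"
proof -
  from u v obtain a b
    where a: "decreases_to_zero a" "\<And>n. d (s n) u \<le> a n"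
      and b: "decreases_to_zero b" "\<And>n. d (s n) v \<le> b n"
    by (auto simp: E_convergent_def)
  from u v have X: "u \<in> X" "v \<in> X" "\<And>n. s n \<in> X"
    by (auto simp: E_convergent_def)
  have "d u v \<le> a n + b n" for n
  proof -
    have "d u v \<le> d u (s n) + d v (s n)"
      using X vm2 by blast
    \<comment> \<open>The convergence bounds have \<open>s n\<close> as first argument, whereas
      \<open>vm2\<close> puts it second.\<close>
    also have "\<dots> \<le> d (s n) u + d (s n) v"
      using X by (intro add_mono dist_commute_le)
    also have "\<dots> \<le> a n + b n"
      using a(2) b(2) by (intro add_mono)
    finally show ?thesis .
  qed
  with a(1) b(1) have "d u v \<le> 0"
    by (rule decreases_to_zero_add_greatest)
  then have "d u v = 0"
    using dist_nonneg X by (simp add: order_antisym)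
  then show ?thesis
    using vm1 X by simp
qed

end

theorem corollary4:
  fixes X :: "'x set" and d :: "'x \<Rightarrow> 'x \<Rightarrow> 'e::riesz_space"
    and Y :: "'y set" and \<rho> :: "'y \<Rightarrow> 'y \<Rightarrow> 'f::riesz_space"
    and f g :: "'x \<Rightarrow> 'y"
  assumes "vector_metric_space X d"
    and "vector_metric_space Y \<rho>"
    and "vectorial_continuous X d Y \<rho> f"
    and "vectorial_continuous X d Y \<rho> g"
    and "E_dense X d {x \<in> X. f x = g x}"
  shows "\<forall>x\<in>X. f x = g x"
proof
  fix x assume x: "x \<in> X"
  with assms(5) obtain s where s: "range s \<subseteq> {x \<in> X. f x = g x}" "E_convergent X d s x"
    by (auto simp: E_dense_def)
  have "E_convergent Y \<rho> (\<lambda>n. f (s n)) (f x)" "E_convergent Y \<rho> (\<lambda>n. g (s n)) (g x)"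
    using assms(3,4) x s(2) by (auto simp: vectorial_continuous_def)
  \<comment> \<open>Every \<open>s n\<close> is a coincidence point, so uniqueness of limits in
    \<open>Y\<close> applies to a single sequence.\<close>
  moreover have "(\<lambda>n. g (s n)) = (\<lambda>n. f (s n))"
    using s(1) by (auto simp: fun_eq_iff image_subset_iff)
  ultimately show "f x = g x"
    using vector_metric_space.E_convergent_unique[OF assms(2)] by simp
qed

end
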